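(* Let $G=(V,E)$ be a finite graph. For $r\in\mathbb{N}\cup\{\infty\}$ we have $$\gamma_r^{\mathrm{stab}}(G)=\max\{k\in\mathbb{N}:\ \xi_r^{\mathrm{stab}}(K_k\star G)=k\}.$$
   Context: $[k]=\{1,\dots,k\}$. The graph $K_k\star G$ has vertex set $[k]\times V$, with an edge between $(c,i)$ and $(c',j)$ when ($c\ne c'$ and $i=j$) or ($c=c'$ and $i\ne j$) or ($c\ne c'$ and $\{i,j\}\in E$). For a finite set $\mathbf{x}$ of noncommuting variables and $m\in\mathbb{N}\cup\{\infty\}$, $\mathbb{R}\langle\mathbf{x}\rangle_m$ is the space of real noncommutative polynomials of degree at most $m$ (all polynomials if $m=\infty$), with involution $*$ reversing words and fixing the variables. A linear functional $L\in\mathbb{R}\langle\mathbf{x}\rangle_{2r}^*$ is symmetric if $L(w)=L(w^* )$ for all words $w$ of degree at most $2r$, tracial if $L(ww')=L(w'w)$ for all words with $\deg(ww')\le2r$, and positive if $L(p^*p)\ge0$ for all $p$ of degree at most $r$. For a set $\mathcal{H}$ of polynomials, $\mathcal{I}_{2r}(\mathcal{H})=\{ph:p\in\mathbb{R}\langle\mathbf{x}\rangle,h\in\mathcal{H},\deg(ph)\le2r\}$. For $r=\infty$ there are no degree restrictions. For a graph $F=(W,E_F)$, with variables $\mathbf{x}=(x_v:v\in W)$, let $\mathcal{H}_F=\{x_v-x_v^2:v\in W\}\cup\{x_vx_w:\{v,w\}\in E_F\}$ and $$\xi_r^{\mathrm{stab}}(F)=\sup\Big\{L\Big(\sum_{v\in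 W}x_v\Big):L\in\mathbb{R}\langle\mathbf{x}\rangle_{2r}^*\text{ tracial, symmetric, positive},\ L(1)=1,\ L=0\text{ on }\mathcal{I}_{2r}(\mathcal{H}_F)\Big\}.$$ Write $i\simeq j$ if $i=j$ or $\{i,j\}\in E$, and let $$\mathcal{H}^{\mathrm{stab}}_{G,k}=\Big\{1-\sum_{i\in V}x_c^i:c\in[k]\Big\}\cup\{x_c^ix_{c'}^j:(i\ne j\text{ and }c=c')\text{ or }(i\simeq j\text{ and }c\ne c')\}.$$ Then $\gamma_r^{\mathrm{stab}}(G)$ is the largest $k\in\mathbb{N}$ for which there is a symmetric, tracial, positive $L\in\mathbb{R}\langle\{x_c^i:c\in[k],i\in V\}\rangle_{2r}^*$ with $L(1)=1$ and $L=0$ on $\mathcal{I}_{2r}(\mathcal{H}^{\mathrm{stab}}_{G,k})$. *)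

theory Defs
  imports
    Complex_Main
    "HOL-Library.Poly_Mapping"
    "HOL-Library.Extended_Nat"
    "HOL-Library.Extended_Real"
begin

text \<open>
  Words form the free monoid. Written additively, it makes \<open>'v list \<Rightarrow>\<^sub>0 real\<close> (with the
  convolution product of \<^theory>\<open>HOL-Library.Poly_Mapping\<close>) the free algebra of real
  noncommutative polynomials in variables indexed by \<open>'v\<close>.
\<close>

instantiation list :: (type) monoid_add
begin

definition zero_list :: "'a list" where
  "zero_list = []"

definition plus_list :: "'a list \<Rightarrow> 'a list \<Rightarrow> 'a list" where
  "plus_list u v = u @ v"

instance
  by standard (simp_all add: zero_list_def plus_list_def)

end

type_synonym 'v ncpoly = "'v list \<Rightarrow>\<^sub>0 real"

definition nc_word :: "'v list \<Rightarrow> 'v ncpoly" where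
  "nc_word w = Poly_Mapping.single w 1"

definition nc_var :: "'v \<Rightarrow> 'v ncpoly" where
  "nc_var v = nc_word [v]"

definition nc_const :: "real \<Rightarrow> 'v ncpoly" where
  "nc_const a = Poly_Mapping.single [] a"

definition nc_star :: "'v ncpoly \<Rightarrow> 'v ncpoly" where
  "nc_star p = Poly_Mapping.map_key rev p"

lemma lookup_nc_star: "Poly_Mapping.lookup (nc_star p) w = Poly_Mapping.lookup p (rev w)"
  by (simp add: nc_star_def map_key.rep_eq)

lemma nc_star_word: "nc_star (nc_word w) = nc_word (rev w)"
  by (rule poly_mapping_eqI)
    (auto simp: lookup_nc_star nc_word_def lookup_single when_def)

lemma nc_word_mult: "nc_word u * nc_word v = nc_word (u @ v)"
  by (simp add: nc_word_def mult_single plus_list_def)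

text \<open>The zero polynomial gets degree 0; it lies in every space below either way.\<close>

definition nc_deg :: "'v ncpoly \<Rightarrow> nat" where
  "nc_deg p = Max (insert 0 (length ` Poly_Mapping.keys p))"

text \<open>
  The variable set is an explicit set \<open>W\<close>, since the statement quantifies over the number
  of colours.
\<close>

definition nc_space :: "'v set \<Rightarrow> enat \<Rightarrow> 'v ncpoly set" where
  "nc_space W m = {p. Poly_Mapping.keys p \<subseteq> lists W \<and> enat (nc_deg p) \<le> m}"

text \<open>
  An element of the dual of \<open>nc_space W m\<close> is represented by any total function that is
  linear on this subspace; its values elsewhere are never used.
\<close>

definition nc_linear :: "'v set \<Rightarrow> enat \<Rightarrow> ('v ncpoly \<Rightarrow> real) \<Rightarrow> bool" where
  "nc_linear W m L \<longleftrightarrow>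
     (\<forall>p \<in> nc_space W m. \<forall>q \<in> nc_space W m. L (p + q) = L p + L q) \<and>
     (\<forall>a. \<forall>p \<in> nc_space W m. L (nc_const a * p) = a * L p)"

definition nc_symmetric :: "'v set \<Rightarrow> enat \<Rightarrow> ('v ncpoly \<Rightarrow> real) \<Rightarrow> bool" where
  "nc_symmetric W m L \<longleftrightarrow>
     (\<forall>w \<in> lists W. enat (length w) \<le> m \<longrightarrow> L (nc_word w) = L (nc_star (nc_word w)))"

definition nc_tracial :: "'v set \<Rightarrow> enat \<Rightarrow> ('v ncpoly \<Rightarrow> real) \<Rightarrow> bool" where
  "nc_tracial W m L \<longleftrightarrow>
     (\<forall>u \<in> lists W. \<forall>v \<in> lists W. enat (length (u @ v)) \<le> m \<longrightarrow>
        L (nc_word u * nc_word v) = L (nc_word v * nc_word u))"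

definition nc_positive :: "'v set \<Rightarrow> enat \<Rightarrow> ('v ncpoly \<Rightarrow> real) \<Rightarrow> bool" where
  "nc_positive W r L \<longleftrightarrow> (\<forall>p \<in> nc_space W r. L (nc_star p * p) \<ge> 0)"

definition nc_ideal :: "'v set \<Rightarrow> enat \<Rightarrow> 'v ncpoly set \<Rightarrow> 'v ncpoly set" where
  "nc_ideal W m H =
     {p * h | p h. p \<in> nc_space W \<infinity> \<and> h \<in> H \<and> enat (nc_deg (p * h)) \<le> m}"

definition nc_feasible ::
    "'v set \<Rightarrow> enat \<Rightarrow> 'v ncpoly set \<Rightarrow> ('v ncpoly \<Rightarrow> real) \<Rightarrow> bool" where
  "nc_feasible W r H L \<longleftrightarrow>
     nc_linear W (2 * r) L \<and> nc_symmetric W (2 * r) L \<and> nc_tracial W (2 * r) L \<and>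
     nc_positive W r L \<and> L 1 = 1 \<and> (\<forall>q \<in> nc_ideal W (2 * r) H. L q = 0)"

definition finite_graph :: "'v set \<Rightarrow> 'v set set \<Rightarrow> bool" where
  "finite_graph V E \<longleftrightarrow> finite V \<and> (\<forall>e \<in> E. e \<subseteq> V \<and> card e = 2)"

definition K_star_verts :: "nat \<Rightarrow> 'v set \<Rightarrow> (nat \<times> 'v) set" where
  "K_star_verts k V = {1..k} \<times> V"

definition K_star_edges :: "nat \<Rightarrow> 'v set \<Rightarrow> 'v set set \<Rightarrow> (nat \<times> 'v) set set" where
  "K_star_edges k V E =
     {{(c, i), (c', j)} | c i c' j.
        c \<in> {1..k} \<and> c' \<in> {1..k} \<and> i \<in> V \<and> j \<in> V \<and>
        (c \<noteq> c' \<and> i = j \<or> c = c' \<and> i \<noteq> j \<or> c \<noteq> c' \<and> {i, j} \<in> E)}"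

definition H_graph :: "'v set \<Rightarrow> 'v set set \<Rightarrow> 'v ncpoly set" where
  "H_graph W F =
     {nc_var v - nc_var v ^ 2 | v. v \<in> W} \<union>
     {nc_var v * nc_var w | v w. v \<in> W \<and> w \<in> W \<and> {v, w} \<in> F}"

text \<open>The supremum is taken in the extended reals, so it is meaningful without a boundedness proof.\<close>

definition xi_stab :: "enat \<Rightarrow> 'v set \<Rightarrow> 'v set set \<Rightarrow> ereal" where
  "xi_stab r W F =
     (SUP L \<in> {L. nc_feasible W r (H_graph W F) L}. ereal (L (\<Sum>v\<in>W. nc_var v)))"

text \<open>The variable \<open>x\<^sub>c\<^sup>i\<close> is \<open>nc_var (c, i)\<close>.\<close>

definition H_stab :: "'v set \<Rightarrow> 'v set set \<Rightarrow> nat \<Rightarrow> (nat \<times> 'v) ncpoly set" where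
  "H_stab V E k =
     {1 - (\<Sum>i\<in>V. nc_var (c, i)) | c. c \<in> {1..k}} \<union>
     {nc_var (c, i) * nc_var (c', j) | c i c' j.
        c \<in> {1..k} \<and> c' \<in> {1..k} \<and> i \<in> V \<and> j \<in> V \<and>
        (i \<noteq> j \<and> c = c' \<or> (i = j \<or> {i, j} \<in> E) \<and> c \<noteq> c')}"

definition gamma_stab_set :: "enat \<Rightarrow> 'v set \<Rightarrow> 'v set set \<Rightarrow> nat set" where
  "gamma_stab_set r V E = {k. \<exists>L. nc_feasible ({1..k} \<times> V) r (H_stab V E k) L}"

definition gamma_stab :: "enat \<Rightarrow> 'v set \<Rightarrow> 'v set set \<Rightarrow> nat" where
  "gamma_stab r V E = Max (gamma_stab_set r V E)"

end

theory Submission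
  imports Defs "HOL-Analysis.Function_Topology"
begin

text \<open>
  Both sets of numbers $k$ coincide. Every functional $L$ feasible for $K_k \star G$ satisfies,
  for a clique $S$, $0 \le L((1 - \sum_{v \in S} x_v)^2) = 1 - \sum_{v \in S} L(x_v)$. Applied to the
  cliques $\{c\} \times V$ this gives $\xi_r \le k$; applied to $[k] \times \{i\}$ it gives the
  value bound $|V|$, hence finiteness. Modulo the ideal of the colouring relations,
  $x_c^i (1 - \sum_j x_c^j) = x_c^i - (x_c^i)^2$, so a functional feasible for $\gamma_r$ is feasible
  for $\xi_r$ with value $k$. Conversely, feasible functionals are bounded by 1 on words, so the
  supremum is attained by compactness. If it equals $k$, then $h_c = 1 - \sum_i x_c^i$ satisfies
  $L(h_c^2) = 0$ for each $c$. Since $L(h v^* v h) \le L(h^2)$ for words $v$, the Cauchy-Schwarz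
  inequality yields $L(u v h_c) = 0$ for all words $u$, $v$ with $|u| \le r$ and $|v| \le r - 1$,
  and these products exhaust the truncated ideal.
\<close>

section \<open>The free algebra and its degree filtration\<close>

declare zero_list_def [simp]

lemma ncpoly_expand:
  fixes p :: "'v ncpoly"
  assumes "finite S" "Poly_Mapping.keys p \<subseteq> S"
  shows "p = (\<Sum>w\<in>S. Poly_Mapping.single w (Poly_Mapping.lookup p w))"
proof (rule poly_mapping_eqI)
  fix k
  have "Poly_Mapping.lookup (\<Sum>w\<in>S. Poly_Mapping.single w (Poly_Mapping.lookup p w)) k
      = (\<Sum>w\<in>S. if w = k then Poly_Mapping.lookup p w else 0)"
    by (simp add: lookup_sum lookup_single when_def)
  also have "\<dots> = Poly_Mapping.lookup p k"
    using assms by (auto simp: not_in_keys_iff_lookup_eq_zero[symmetric])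
  finally show "Poly_Mapping.lookup p k = Poly_Mapping.lookup (\<Sum>w\<in>S. Poly_Mapping.single w (Poly_Mapping.lookup p w)) k" ..
qed

lemma ncpoly_mult_expand:
  fixes p q :: "'v ncpoly"
  shows "p * q = (\<Sum>u\<in>Poly_Mapping.keys p. \<Sum>v\<in>Poly_Mapping.keys q.
           Poly_Mapping.single (u @ v) (Poly_Mapping.lookup p u * Poly_Mapping.lookup q v))"
proof -
  have "p * q = (\<Sum>u\<in>Poly_Mapping.keys p. Poly_Mapping.single u (Poly_Mapping.lookup p u)) *
                (\<Sum>v\<in>Poly_Mapping.keys q. Poly_Mapping.single v (Poly_Mapping.lookup q v))"
    using ncpoly_expand[of "Poly_Mapping.keys p" p] ncpoly_expand[of "Poly_Mapping.keys q" q]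
    by simp
  then show ?thesis
    by (simp add: sum_product mult_single plus_list_def)
qed

lemma nc_word_Nil [simp]: "nc_word [] = 1"
  by (metis nc_word_def zero_list_def single_one)

lemma nc_word_Cons: "nc_word (v # w) = nc_var v * nc_word w"
  by (simp add: nc_var_def nc_word_mult)

lemma lookup_nc_const_mult: "Poly_Mapping.lookup (nc_const a * p) w = a * Poly_Mapping.lookup p w"
proof -
  \<comment> \<open>For \<open>a = 0\<close> the polynomial \<open>nc_const a\<close> has no keys,
    so the expansion over keys degenerates and that case is separate.\<close>
  have "Poly_Mapping.lookup (nc_const a * p) w
      = Poly_Mapping.lookup (\<Sum>v\<in>Poly_Mapping.keys p. Poly_Mapping.single v (a * Poly_Mapping.lookup p v)) w"
    by (cases "a = 0") (simp_all add: nc_const_def ncpoly_mult_expand[of "Poly_Mapping.single [] a"])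
  also have "\<dots> = a * Poly_Mapping.lookup p w"
    by (auto simp: lookup_sum lookup_single when_def sum.delta not_in_keys_iff_lookup_eq_zero[symmetric])
  finally show ?thesis .
qed

lemma nc_const_commute: "p * nc_const a = nc_const a * p"
proof (rule poly_mapping_eqI)
  fix w
  have "Poly_Mapping.lookup (p * nc_const a) w
      = Poly_Mapping.lookup (\<Sum>v\<in>Poly_Mapping.keys p. Poly_Mapping.single v (a * Poly_Mapping.lookup p v)) w"
    by (cases "a = 0")
      (simp_all add: nc_const_def ncpoly_mult_expand[of _ "Poly_Mapping.single [] a"] mult.commute)
  also have "\<dots> = a * Poly_Mapping.lookup p w"
    by (auto simp: lookup_sum lookup_single when_def sum.delta not_in_keys_iff_lookup_eq_zero[symmetric])
  finally show "Poly_Mapping.lookup (p * nc_const a) w = Poly_Mapping.lookup (nc_const a * p) w"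
    by (simp add: lookup_nc_const_mult)
qed

lemma single_eq_const_word: "Poly_Mapping.single w a = nc_const a * nc_word w"
  by (simp add: nc_const_def nc_word_def mult_single plus_list_def)

section \<open>The involution\<close>

lemma nc_star_add: "nc_star (p + q) = nc_star p + nc_star q"
  by (rule poly_mapping_eqI) (simp add: lookup_nc_star lookup_add)

lemma nc_star_diff: "nc_star (p - q) = nc_star p - nc_star q"
  by (rule poly_mapping_eqI) (simp add: lookup_nc_star lookup_minus)

lemma nc_star_zero [simp]: "nc_star 0 = 0"
  by (rule poly_mapping_eqI) (simp add: lookup_nc_star)

lemma nc_star_sum: "nc_star (sum g S) = (\<Sum>x\<in>S. nc_star (g x))"
  by (induction S rule: infinite_finite_induct) (simp_all add: nc_star_add)

lemma nc_star_one [simp]: "nc_star 1 = 1"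
  using nc_star_word[of "[]"] by simp

lemma nc_star_var [simp]: "nc_star (nc_var v) = nc_var v"
  by (simp add: nc_var_def nc_star_word)

lemma nc_star_single: "nc_star (Poly_Mapping.single w a) = Poly_Mapping.single (rev w) a"
  by (rule poly_mapping_eqI) (auto simp: lookup_nc_star lookup_single when_def)

lemma nc_star_expand:
  "nc_star p = (\<Sum>w\<in>Poly_Mapping.keys p. Poly_Mapping.single (rev w) (Poly_Mapping.lookup p w))"
  by (subst ncpoly_expand[of "Poly_Mapping.keys p" p]) (simp_all add: nc_star_sum nc_star_single)

lemma nc_star_mult: "nc_star (p * q) = nc_star q * nc_star p"
proof -
  have "nc_star (p * q) = (\<Sum>u\<in>Poly_Mapping.keys p. \<Sum>v\<in>Poly_Mapping.keys q.
           Poly_Mapping.single (rev v @ rev u) (Poly_Mapping.lookup p u * Poly_Mapping.lookup q v))"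
    by (simp add: ncpoly_mult_expand nc_star_sum nc_star_single)
  also have "\<dots> = (\<Sum>v\<in>Poly_Mapping.keys q. \<Sum>u\<in>Poly_Mapping.keys p.
           Poly_Mapping.single (rev v) (Poly_Mapping.lookup q v) * Poly_Mapping.single (rev u) (Poly_Mapping.lookup p u))"
    by (subst sum.swap) (simp add: mult_single plus_list_def mult.commute)
  also have "\<dots> = nc_star q * nc_star p"
    by (simp add: nc_star_expand sum_product)
  finally show ?thesis .
qed

lemma nc_star_star [simp]: "nc_star (nc_star p) = p"
  by (rule poly_mapping_eqI) (simp add: lookup_nc_star)

lemma keys_nc_star: "Poly_Mapping.keys (nc_star p) = rev ` Poly_Mapping.keys p"
proof -
  have "w \<in> rev ` Poly_Mapping.keys p" if "rev w \<in> Poly_Mapping.keys p" for w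
    using that by (metis image_eqI rev_rev_ident)
  then show ?thesis
    by (auto simp: in_keys_iff lookup_nc_star)
qed

section \<open>Degree and the truncated spaces\<close>

lemma nc_deg_le_enat_iff:
  "enat (nc_deg p) \<le> m \<longleftrightarrow> (\<forall>w\<in>Poly_Mapping.keys p. enat (length w) \<le> m)"
  by (cases m) (auto simp: nc_deg_def)

lemma length_le_nc_deg: "w \<in> Poly_Mapping.keys p \<Longrightarrow> length w \<le> nc_deg p"
  by (simp add: nc_deg_def)

lemma nc_space_iff:
  "p \<in> nc_space W m \<longleftrightarrow> (\<forall>w\<in>Poly_Mapping.keys p. w \<in> lists W \<and> enat (length w) \<le> m)"
  by (auto simp: nc_space_def nc_deg_le_enat_iff)

lemma nc_space_mono: "p \<in> nc_space W m \<Longrightarrow> m \<le> n \<Longrightarrow> p \<in> nc_space W n"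
  by (auto simp: nc_space_iff intro: order_trans)

lemma nc_space_add: "p \<in> nc_space W m \<Longrightarrow> q \<in> nc_space W m \<Longrightarrow> p + q \<in> nc_space W m"
  using Poly_Mapping.keys_add[of p q] by (auto simp: nc_space_iff)

lemma nc_space_diff: "p \<in> nc_space W m \<Longrightarrow> q \<in> nc_space W m \<Longrightarrow> p - q \<in> nc_space W m"
  using keys_diff[of p q] by (auto simp: nc_space_iff)

lemma nc_space_zero [simp]: "0 \<in> nc_space W m"
  by (simp add: nc_space_iff)

lemma nc_space_sum: "(\<And>x. x \<in> S \<Longrightarrow> g x \<in> nc_space W m) \<Longrightarrow> sum g S \<in> nc_space W m"
  by (induction S rule: infinite_finite_induct) (simp_all add: nc_space_add)

lemma nc_space_mult:
  assumes "p \<in> nc_space W m" "q \<in> nc_space W n"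
  shows "p * q \<in> nc_space W (m + n)"
proof -
  have "w \<in> lists W \<and> enat (length w) \<le> m + n" if w: "w \<in> Poly_Mapping.keys (p * q)" for w
  proof -
    obtain u v where "u \<in> Poly_Mapping.keys p" "v \<in> Poly_Mapping.keys q" "w = u @ v"
      using keys_mult[of p q] w by (auto simp: plus_list_def)
    moreover have "enat (length u + length v) \<le> m + n"
      if "enat (length u) \<le> m" "enat (length v) \<le> n"
      using add_mono[OF that] by simp
    ultimately show ?thesis
      using assms by (auto simp: nc_space_iff)
  qed
  then show ?thesis by (auto simp: nc_space_iff)
qed

lemma nc_space_const_mult: "p \<in> nc_space W m \<Longrightarrow> nc_const a * p \<in> nc_space W m"
  by (auto simp: nc_space_iff in_keys_iff lookup_nc_const_mult)

lemma nc_space_star: "p \<in> nc_space W m \<Longrightarrow> nc_star p \<in> nc_space W m"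
  by (auto simp: nc_space_iff keys_nc_star)

lemma nc_space_word: "w \<in> lists W \<Longrightarrow> enat (length w) \<le> m \<Longrightarrow> nc_word w \<in> nc_space W m"
  by (simp add: nc_space_iff nc_word_def)

lemma nc_space_one [simp]: "1 \<in> nc_space W m"
  using nc_space_word[of "[]" W m] by (simp add: zero_enat_def[symmetric])

lemma nc_space_var: "v \<in> W \<Longrightarrow> 1 \<le> m \<Longrightarrow> nc_var v \<in> nc_space W m"
  by (simp add: nc_var_def nc_space_word one_enat_def)

lemma nc_deg_mult_le: "nc_deg (p * q) \<le> nc_deg p + nc_deg q"
proof -
  have "p * q \<in> nc_space UNIV (enat (nc_deg p) + enat (nc_deg q))"
    by (intro nc_space_mult) (auto simp: nc_space_def)
  then show ?thesis by (simp add: nc_space_def)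
qed

lemma nc_deg_attained:
  assumes "p \<noteq> 0"
  obtains w where "w \<in> Poly_Mapping.keys p" "length w = nc_deg p"
proof -
  have ne: "Poly_Mapping.keys p \<noteq> {}" using assms by simp
  then have "nc_deg p = Max (length ` Poly_Mapping.keys p)"
    by (simp add: nc_deg_def)
  moreover have "Max (length ` Poly_Mapping.keys p) \<in> length ` Poly_Mapping.keys p"
    using ne by (intro Max_in) auto
  ultimately show ?thesis using that by auto
qed

text \<open>Top-degree terms cannot cancel: the product of two words of maximal length arises from
  one pair of monomials only. This turns a degree bound on \<open>p * h\<close> into one on each
  word of \<open>p\<close>.\<close>

lemma nc_deg_mult:
  assumes "p \<noteq> 0" "q \<noteq> 0"
  shows "nc_deg (p * q) = nc_deg p + nc_deg q"
proof (rule antisym[OF nc_deg_mult_le])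
  obtain u where u: "u \<in> Poly_Mapping.keys p" "length u = nc_deg p"
    using assms(1) by (rule nc_deg_attained)
  obtain v where v: "v \<in> Poly_Mapping.keys q" "length v = nc_deg q"
    using assms(2) by (rule nc_deg_attained)
  \<comment> \<open>a factorization of \<open>u @ v\<close> into monomials of \<open>p\<close> and \<open>q\<close> is forced by the lengths\<close>
  have split: "u' @ v' = u @ v \<longleftrightarrow> u' = u \<and> v' = v"
    if "u' \<in> Poly_Mapping.keys p" "v' \<in> Poly_Mapping.keys q" for u' v'
  proof
    assume eq: "u' @ v' = u @ v"
    have "length u' \<le> length u" "length v' \<le> length v"
      using length_le_nc_deg that u v by fastforce+
    moreover have "length u' + length v' = length u + length v"
      using arg_cong[OF eq, of length] by simp
    ultimately show "u' = u \<and> v' = v" using eq by simp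
  qed auto
  have "Poly_Mapping.lookup (p * q) (u @ v) = (\<Sum>u'\<in>Poly_Mapping.keys p. \<Sum>v'\<in>Poly_Mapping.keys q.
          if u' = u then if v' = v then Poly_Mapping.lookup p u * Poly_Mapping.lookup q v else 0 else 0)"
    unfolding ncpoly_mult_expand lookup_sum
    by (intro sum.cong refl) (auto simp: lookup_single when_def split)
  also have "\<dots> = (\<Sum>u'\<in>Poly_Mapping.keys p. if u' = u then Poly_Mapping.lookup p u * Poly_Mapping.lookup q v else 0)"
    using v by (intro sum.cong refl) auto
  also have "\<dots> = Poly_Mapping.lookup p u * Poly_Mapping.lookup q v"
    using u by simp
  finally have "u @ v \<in> Poly_Mapping.keys (p * q)"
    using u v by (simp add: in_keys_iff)
  then show "nc_deg p + nc_deg q \<le> nc_deg (p * q)"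
    using length_le_nc_deg[of "u @ v" "p * q"] u v by simp
qed

lemma nc_deg_var_mult [simp]: "nc_deg (nc_var x * nc_var y) = 2"
  by (simp add: nc_var_def nc_word_mult) (simp add: nc_deg_def nc_word_def)

section \<open>Functionals given by their values on words\<close>

text \<open>The linear extension of a function on words. Functionals thereby become points of a
  product of real lines, where compactness arguments apply.\<close>

definition nc_ext :: "('v list \<Rightarrow> real) \<Rightarrow> 'v ncpoly \<Rightarrow> real" where
  "nc_ext f p = (\<Sum>w\<in>Poly_Mapping.keys p. Poly_Mapping.lookup p w * f w)"

lemma nc_ext_superset:
  "finite S \<Longrightarrow> Poly_Mapping.keys p \<subseteq> S \<Longrightarrow> nc_ext f p = (\<Sum>w\<in>S. Poly_Mapping.lookup p w * f w)"
  unfolding nc_ext_def by (intro sum.mono_neutral_left) (auto simp: in_keys_iff)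

lemma nc_ext_add: "nc_ext f (p + q) = nc_ext f p + nc_ext f q"
proof -
  define S where "S = Poly_Mapping.keys p \<union> Poly_Mapping.keys q"
  have S: "finite S" "Poly_Mapping.keys p \<subseteq> S" "Poly_Mapping.keys q \<subseteq> S"
    "Poly_Mapping.keys (p + q) \<subseteq> S"
    using Poly_Mapping.keys_add[of p q] by (auto simp: S_def)
  show ?thesis
    using S by (simp add: nc_ext_superset[of S] lookup_add algebra_simps sum.distrib)
qed

lemma nc_ext_const_mult: "nc_ext f (nc_const a * p) = a * nc_ext f p"
proof -
  have "Poly_Mapping.keys (nc_const a * p) \<subseteq> Poly_Mapping.keys p"
    by (auto simp: in_keys_iff lookup_nc_const_mult)
  then show ?thesis
    by (simp add: nc_ext_superset[of "Poly_Mapping.keys p"] lookup_nc_const_mult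
        sum_distrib_left mult.assoc)
qed

lemma nc_ext_zero [simp]: "nc_ext f 0 = 0"
  by (simp add: nc_ext_def)

lemma nc_ext_diff: "nc_ext f (p - q) = nc_ext f p - nc_ext f q"
  using nc_ext_add[of f "p - q" q] by simp

lemma nc_ext_sum: "nc_ext f (sum g S) = (\<Sum>x\<in>S. nc_ext f (g x))"
  by (induction S rule: infinite_finite_induct) (simp_all add: nc_ext_add)

lemma nc_ext_single: "nc_ext f (Poly_Mapping.single w a) = a * f w"
  by (cases "a = 0") (simp_all add: nc_ext_def)

lemma nc_ext_word [simp]: "nc_ext f (nc_word w) = f w"
  by (simp add: nc_word_def nc_ext_single)

lemma nc_ext_mult:
  "nc_ext f (p * q) = (\<Sum>u\<in>Poly_Mapping.keys p. \<Sum>v\<in>Poly_Mapping.keys q.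
     Poly_Mapping.lookup p u * Poly_Mapping.lookup q v * f (u @ v))"
  by (simp add: ncpoly_mult_expand nc_ext_sum nc_ext_single)

text \<open>Traciality is imposed on words only; bilinear expansion carries it to polynomials, with
  \<open>s + t \<le> m\<close> keeping every word \<open>u @ v\<close> in range.\<close>

lemma nc_ext_tracial:
  assumes "nc_tracial W m (nc_ext f)" "p \<in> nc_space W s" "q \<in> nc_space W t" "s + t \<le> m"
  shows "nc_ext f (p * q) = nc_ext f (q * p)"
proof -
  have "f (u @ v) = f (v @ u)" if "u \<in> Poly_Mapping.keys p" "v \<in> Poly_Mapping.keys q" for u v
  proof -
    have "enat (length u) \<le> s" "enat (length v) \<le> t" "u \<in> lists W" "v \<in> lists W"
      using assms that by (auto simp: nc_space_iff)
    moreover from this have "enat (length (u @ v)) \<le> m"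
      using add_mono[of "enat (length u)" s "enat (length v)" t] assms(4) by simp
    ultimately show ?thesis
      using assms(1) unfolding nc_tracial_def nc_word_mult nc_ext_word by blast
  qed
  then show ?thesis
    unfolding nc_ext_mult by (subst sum.swap) (auto intro!: sum.cong)
qed

lemma nc_ext_symmetric:
  assumes "nc_symmetric W m (nc_ext f)" "p \<in> nc_space W m"
  shows "nc_ext f (nc_star p) = nc_ext f p"
proof -
  have "f (rev w) = f w" if "w \<in> Poly_Mapping.keys p" for w
  proof -
    have "w \<in> lists W" "enat (length w) \<le> m"
      using assms that by (auto simp: nc_space_iff)
    then show ?thesis
      using assms(1) unfolding nc_symmetric_def nc_star_word nc_ext_word by fastforce
  qed
  then show ?thesis
    unfolding nc_star_expand nc_ext_sum nc_ext_single unfolding nc_ext_def by simp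
qed

lemma nc_linear_ext: "nc_linear W m (nc_ext f)"
  by (simp add: nc_linear_def nc_ext_add nc_ext_const_mult)

lemma nc_linear_sum:
  assumes "nc_linear W m L" "finite S" "\<And>x. x \<in> S \<Longrightarrow> g x \<in> nc_space W m"
  shows "L (sum g S) = (\<Sum>x\<in>S. L (g x))"
proof -
  \<comment> \<open>Homogeneity with scalar 0 supplies the empty sum.\<close>
  have "L (nc_const 0 * 0) = 0 * L 0"
    using assms(1) nc_space_zero unfolding nc_linear_def by blast
  then have "L 0 = 0" by simp
  with assms(2,3) show ?thesis
  proof (induction S)
    case (insert x S)
    then show ?case
      using assms(1) nc_space_sum[of S g W m] unfolding nc_linear_def by auto
  qed simp
qed

lemma nc_linear_eq_ext:
  assumes "nc_linear W m L" "p \<in> nc_space W m"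
    and "\<And>w. w \<in> lists W \<Longrightarrow> enat (length w) \<le> m \<Longrightarrow> f w = L (nc_word w)"
  shows "L p = nc_ext f p"
proof -
  have space: "nc_word w \<in> nc_space W m" if "w \<in> Poly_Mapping.keys p" for w
    using assms(2) that by (intro nc_space_word) (auto simp: nc_space_iff)
  have "L p = L (\<Sum>w\<in>Poly_Mapping.keys p. nc_const (Poly_Mapping.lookup p w) * nc_word w)"
    using ncpoly_expand[of "Poly_Mapping.keys p" p] by (simp add: single_eq_const_word)
  also have "\<dots> = (\<Sum>w\<in>Poly_Mapping.keys p. Poly_Mapping.lookup p w * L (nc_word w))"
    using space assms(1)
    by (subst nc_linear_sum[OF assms(1)]) (auto simp: nc_space_const_mult nc_linear_def)
  also have "\<dots> = nc_ext f p"
    unfolding nc_ext_def using assms(2,3) by (intro sum.cong) (auto simp: nc_space_iff)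
  finally show ?thesis .
qed

section \<open>Vanishing on truncated ideals\<close>

lemma nc_ext_mult_vanish:
  assumes "\<And>w. w \<in> Poly_Mapping.keys p \<Longrightarrow> nc_ext f (nc_word w * h) = 0"
  shows "nc_ext f (p * h) = 0"
proof -
  have "p * h = (\<Sum>w\<in>Poly_Mapping.keys p. nc_const (Poly_Mapping.lookup p w) * nc_word w) * h"
    using ncpoly_expand[of "Poly_Mapping.keys p" p] by (simp add: single_eq_const_word)
  then show ?thesis
    using assms by (simp add: sum_distrib_right mult.assoc nc_ext_sum nc_ext_const_mult)
qed

text \<open>Subadditivity of the degree puts the word multiples into the ideal; additivity shows
  conversely that no word of \<open>p\<close> exceeds the degree budget of \<open>p * h\<close>, so
  the word multiples suffice.\<close>

lemma nc_ideal_vanish_iff: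
  "(\<forall>q\<in>nc_ideal W m H. nc_ext f q = 0) \<longleftrightarrow>
   (\<forall>h\<in>H. \<forall>w\<in>lists W. enat (length w + nc_deg h) \<le> m \<longrightarrow> nc_ext f (nc_word w * h) = 0)"
  (is "?ideal \<longleftrightarrow> ?words")
proof
  assume ideal: ?ideal
  show ?words
  proof (intro ballI impI)
    fix h w assume *: "h \<in> H" "w \<in> lists W" "enat (length w + nc_deg h) \<le> m"
    have "nc_deg (nc_word w * h) \<le> length w + nc_deg h"
      using nc_deg_mult_le[of "nc_word w" h] by (simp add: nc_deg_def nc_word_def)
    then have "enat (nc_deg (nc_word w * h)) \<le> m"
      using *(3) by (meson enat_ord_simps(1) order_trans)
    then have "nc_word w * h \<in> nc_ideal W m H"
      using * nc_space_word[of w W \<infinity>] by (auto simp: nc_ideal_def)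
    then show "nc_ext f (nc_word w * h) = 0" using ideal by blast
  qed
next
  assume words: ?words
  show ?ideal
  proof
    fix q assume "q \<in> nc_ideal W m H"
    then obtain p h where q: "q = p * h" "p \<in> nc_space W \<infinity>" "h \<in> H" "enat (nc_deg (p * h)) \<le> m"
      by (auto simp: nc_ideal_def)
    show "nc_ext f q = 0"
    \<comment> \<open>Degree additivity fails for the zero polynomial, whose degree is 0 by
      convention.\<close>
    proof (cases "p = 0 \<or> h = 0")
      case False
      have "nc_ext f (nc_word w * h) = 0" if "w \<in> Poly_Mapping.keys p" for w
      proof -
        have "length w + nc_deg h \<le> nc_deg (p * h)"
          using False length_le_nc_deg[OF that] by (simp add: nc_deg_mult)
        then have "enat (length w + nc_deg h) \<le> m"
          using q(4) by (meson enat_ord_simps(1) order_trans)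
        then show ?thesis
          using words q(2,3) that by (auto simp: nc_space_iff)
      qed
      then show ?thesis
        unfolding q(1) by (rule nc_ext_mult_vanish)
    qed (auto simp: q(1))
  qed
qed

section \<open>Feasible functionals of a graph\<close>

lemma split_word_enat:
  fixes r s :: enat
  assumes "enat (length w) + s \<le> 2 * r" "s \<le> r"
  obtains u v where "w = u @ v" "enat (length u) \<le> r" "s + enat (length v) \<le> r"
proof (cases r)
  case (enat n)
  then obtain m where m: "s = enat m" using assms(2) by (cases s) auto
  show ?thesis
    \<comment> \<open>At most \<open>2n - m - n = n - m\<close> letters remain after the first
      \<open>n\<close>; if \<open>w\<close> is shorter than that, the remainder is empty and
      \<open>s \<le> r\<close> is the bound.\<close>
    using assms that[of "take n w" "drop n w"] enat m
    by (auto simp: numeral_eq_enat)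
next
  case infinity
  then show ?thesis using that[of "[]" w] by simp
qed

text \<open>The functional is given by word values, so linearity holds on all polynomials and only
  the other conditions carry degree bounds.\<close>

locale nc_graph_functional =
  fixes W :: "'w set" and F :: "'w set set" and r :: enat and f :: "'w list \<Rightarrow> real"
  assumes feasible: "nc_feasible W r (H_graph W F) (nc_ext f)"
begin

abbreviation L :: "'w ncpoly \<Rightarrow> real" where "L \<equiv> nc_ext f"

lemma L_one: "L 1 = 1"
  using feasible by (simp add: nc_feasible_def)

lemma L_positive: "p \<in> nc_space W r \<Longrightarrow> 0 \<le> L (nc_star p * p)"
  using feasible by (simp add: nc_feasible_def nc_positive_def)

lemma L_tracial:
  "p \<in> nc_space W s \<Longrightarrow> q \<in> nc_space W t \<Longrightarrow> s + t \<le> 2 * r \<Longrightarrow> L (p * q) = L (q * p)"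
  using feasible by (auto simp: nc_feasible_def intro: nc_ext_tracial)

lemma L_symmetric: "p \<in> nc_space W (2 * r) \<Longrightarrow> L (nc_star p) = L p"
  using feasible by (auto simp: nc_feasible_def intro: nc_ext_symmetric)

text \<open>The two arguments are each other's adjoints. Hence \<open>L (nc_star a * b)\<close> is a
  symmetric bilinear form, positive semidefinite by \<open>L_positive\<close>.\<close>

lemma L_star_mult_commute:
  assumes "a \<in> nc_space W r" "b \<in> nc_space W r"
  shows "L (nc_star b * a) = L (nc_star a * b)"
proof -
  have "nc_star a * b \<in> nc_space W (2 * r)"
    using nc_space_mult[OF nc_space_star[OF assms(1)] assms(2)] by (simp add: mult_2)
  then show ?thesis
    using L_symmetric[of "nc_star a * b"] by (simp add: nc_star_mult)
qed

lemma L_word_idem: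
  assumes "w \<in> lists W" "x \<in> W" "enat (length w) + 2 \<le> 2 * r"
  shows "L (nc_word w * (nc_var x - nc_var x ^ 2)) = 0"
proof -
  let ?h = "nc_var x - nc_var x ^ 2"
  have "?h \<in> H_graph W F"
    using assms(2) by (auto simp: H_graph_def)
  moreover have "enat (length w + nc_deg ?h) \<le> 2 * r"
  proof -
    have "?h \<in> nc_space W 2"
      using nc_space_mult[of "nc_var x" W 1 "nc_var x" 1] assms(2)
      by (intro nc_space_diff) (auto simp: nc_space_var power2_eq_square one_add_one)
    then have "enat (nc_deg ?h) \<le> 2" by (simp add: nc_space_def)
    then have "enat (length w) + enat (nc_deg ?h) \<le> enat (length w) + 2"
      by (rule add_left_mono)
    then show ?thesis
      using assms(3) by (metis order_trans plus_enat_simps(1))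
  qed
  ultimately show ?thesis
    using feasible assms(1) nc_ideal_vanish_iff[of W "2 * r" "H_graph W F" f]
    unfolding nc_feasible_def by blast
qed

lemma L_word_edge:
  assumes "w \<in> lists W" "x \<in> W" "y \<in> W" "{x, y} \<in> F" "enat (length w) + 2 \<le> 2 * r"
  shows "L (nc_word w * (nc_var x * nc_var y)) = 0"
proof -
  have "nc_var x * nc_var y \<in> H_graph W F"
    using assms by (auto simp: H_graph_def)
  moreover have "enat (length w + nc_deg (nc_var x * nc_var y)) \<le> 2 * r"
    using assms(5) by (simp add: numeral_eq_enat)
  ultimately show ?thesis
    using feasible assms(1) nc_ideal_vanish_iff[of W "2 * r" "H_graph W F" f]
    unfolding nc_feasible_def by fastforce
qed

text \<open>The ideal consists of left multiples \<open>p * h\<close>, so the relation is available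
  at the right end of a product; cyclicity has to bring interior factors there.\<close>

lemma L_idem:
  assumes "p \<in> nc_space W s" "x \<in> W" "s + 2 \<le> 2 * r"
  shows "L (p * nc_var x * nc_var x) = L (p * nc_var x)"
proof -
  have "L (p * (nc_var x - nc_var x ^ 2)) = 0"
  proof (rule nc_ext_mult_vanish)
    fix w assume "w \<in> Poly_Mapping.keys p"
    then have "w \<in> lists W" "enat (length w) \<le> s"
      using assms(1) by (auto simp: nc_space_iff)
    moreover from this have "enat (length w) + 2 \<le> 2 * r"
      using add_right_mono order_trans assms(3) by blast
    ultimately show "L (nc_word w * (nc_var x - nc_var x ^ 2)) = 0"
      using assms(2) by (intro L_word_idem)
  qed
  then show ?thesis
    by (simp add: right_diff_distrib nc_ext_diff power2_eq_square mult.assoc)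
qed

text \<open>
  Combines positivity on \<open>(1 - x) a\<close> with \<open>L (a\<^sup>* x\<^sup>2 a) = L (a\<^sup>* x a)\<close>, which holds by cyclicity.
\<close>

lemma L_contraction:
  assumes "a \<in> nc_space W s" "x \<in> W" "s + 1 \<le> r"
  shows "L (nc_star (nc_var x * a) * (nc_var x * a)) \<le> L (nc_star a * a)"
proof -
  let ?x = "nc_var x"
  have x1: "?x \<in> nc_space W 1"
    using assms(2) by (simp add: nc_space_var)
  have xa: "?x * a \<in> nc_space W r"
    using nc_space_mult[OF x1 assms(1)] assms(3) by (auto simp: add.commute intro: nc_space_mono)
  \<comment> \<open>Degree budgets for membership of \<open>a\<close>, the two uses of traciality
    and \<open>L_idem\<close>; the largest total is \<open>2s + 2\<close>.\<close>
  have s: "s \<le> r" "(s + 1) + s \<le> 2 * r" "((s + 1) + 1) + s \<le> 2 * r" "(s + s) + 2 \<le> 2 * r"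
    using assms(3) by (cases s; cases r; simp add: one_enat_def numeral_eq_enat)+
  have a: "a \<in> nc_space W r"
    using assms(1) s(1) by (rule nc_space_mono)
  have ax: "nc_star a * ?x \<in> nc_space W (s + 1)"
    by (intro nc_space_mult nc_space_star assms x1)
  have axx: "nc_star a * ?x * ?x \<in> nc_space W ((s + 1) + 1)"
    by (intro nc_space_mult ax x1)
  \<comment> \<open>Moving \<open>a\<close> cyclically to the front exposes \<open>x * x\<close> at
    the right end; after the reduction \<open>a\<close> moves back.\<close>
  have "L (nc_star a * ?x * ?x * a) = L (a * nc_star a * ?x * ?x)"
    using L_tracial[OF axx assms(1)] s by (simp add: mult.assoc)
  also have "\<dots> = L (a * nc_star a * ?x)"
    by (rule L_idem[OF nc_space_mult[OF assms(1) nc_space_star[OF assms(1)]] assms(2) s(4)])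
  also have "\<dots> = L (nc_star a * ?x * a)"
    using L_tracial[OF ax assms(1)] s by (simp add: mult.assoc)
  finally have idem: "L (nc_star a * (?x * (?x * a))) = L (nc_star a * (?x * a))"
    by (simp add: mult.assoc)
  have "0 \<le> L (nc_star (a - ?x * a) * (a - ?x * a))"
    by (intro L_positive nc_space_diff a xa)
  also have "\<dots> = L (nc_star a * a) - L (nc_star (?x * a) * (?x * a))"
    by (simp add: nc_star_diff nc_star_mult left_diff_distrib right_diff_distrib nc_ext_diff
        mult.assoc idem)
  finally show ?thesis by simp
qed

text \<open>The leftmost letters are removed one at a time by \<open>L_contraction\<close>. With
  \<open>a = 1\<close> this bounds the values on words; with a null polynomial \<open>a\<close> it
  shows that its word multiples are null too.\<close>

lemma L_word_contraction:
  assumes "w \<in> lists W" "a \<in> nc_space W s" "s + enat (length w) \<le> r"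
  shows "L (nc_star (nc_word w * a) * (nc_word w * a)) \<le> L (nc_star a * a)"
  using assms(1,3)
proof (induction w rule: list.induct)
  case (Cons x w)
  have le: "s + enat (length w) + 1 \<le> r"
    using Cons.prems(2) by (cases s; cases r; simp add: one_enat_def)
  have wa: "nc_word w * a \<in> nc_space W (s + enat (length w))"
    using Cons.prems(1) nc_space_mult[OF nc_space_word[of w W "enat (length w)"] assms(2)]
    by (simp add: add.commute)
  have "L (nc_star (nc_word (x # w) * a) * (nc_word (x # w) * a))
      \<le> L (nc_star (nc_word w * a) * (nc_word w * a))"
    using L_contraction[OF wa _ le] Cons.prems(1) by (simp add: nc_word_Cons mult.assoc)
  also have "\<dots> \<le> L (nc_star a * a)"
    using le Cons.prems(1) by (intro Cons.IH) (auto intro: order_trans[OF _ le])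
  finally show ?case .
qed simp

text \<open>Along the line \<open>a + t b\<close> the form is affine in \<open>t\<close>, since its
  quadratic coefficient vanishes; a nonzero slope would contradict positivity.\<close>

lemma L_cauchy_schwarz_zero:
  assumes "a \<in> nc_space W r" "b \<in> nc_space W r" "L (nc_star b * b) = 0"
  shows "L (nc_star a * b) = 0"
proof (rule ccontr)
  define c where "c = L (nc_star a * b)"
  assume "L (nc_star a * b) \<noteq> 0"
  then have c: "c \<noteq> 0" by (simp add: c_def)
  \<comment> \<open>Solves \<open>L (nc_star a * a) + 2 * t * c = -1\<close>.\<close>
  define t where "t = - (L (nc_star a * a) + 1) / (2 * c)"
  have star_t: "nc_star (nc_const t * b) = nc_const t * nc_star b"
    by (rule poly_mapping_eqI) (simp add: lookup_nc_star lookup_nc_const_mult)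
  have "0 \<le> L (nc_star (a + nc_const t * b) * (a + nc_const t * b))"
    by (intro L_positive nc_space_add nc_space_const_mult assms)
  also have "nc_star (a + nc_const t * b) * (a + nc_const t * b)
      = nc_star a * a + nc_const t * (nc_star a * b) + nc_const t * (nc_star b * a)
        + nc_const t * (nc_const t * (nc_star b * b))"
  proof -
    have "p * (nc_const t * q) = nc_const t * (p * q)" for p q :: "'w ncpoly"
      by (metis mult.assoc nc_const_commute)
    from this[of "nc_star a" b] this[of "nc_star b" b] show ?thesis
      by (simp add: nc_star_add star_t distrib_left distrib_right mult.assoc)
  qed
  also have "L \<dots> = L (nc_star a * a) + 2 * t * c"
    using L_star_mult_commute[OF assms(1,2)] assms(3)
    by (simp add: nc_ext_add nc_ext_const_mult c_def)
  also have "\<dots> = -1"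
    using c by (simp add: t_def field_simps)
  finally show False by simp
qed

text \<open>The word is cut into two halves of length at most \<open>r\<close>, each of norm at most
  1 by contraction from the polynomial 1. Positivity on \<open>a + b\<close> and
  \<open>a - b\<close> bounds their inner product by the mean of the squared norms.\<close>

lemma L_word_bound:
  assumes "w \<in> lists W" "enat (length w) \<le> 2 * r"
  shows "\<bar>f w\<bar> \<le> 1"
proof -
  obtain u v where uv: "w = u @ v" "enat (length u) \<le> r" "0 + enat (length v) \<le> r"
    using assms(2) by (auto intro: split_word_enat[of w 0] simp: zero_enat_def[symmetric])
  \<comment> \<open>Reversed so that \<open>nc_star a\<close> is the word \<open>u\<close>.\<close>
  define a where "a = nc_word (rev u)"
  define b where "b = (nc_word v :: 'w ncpoly)"
  have W: "rev u \<in> lists W" "v \<in> lists W"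
    using assms(1) uv(1) by auto
  have ab: "a \<in> nc_space W r" "b \<in> nc_space W r"
    unfolding a_def b_def using W uv(2,3) by (intro nc_space_word; simp)+
  have "L (nc_star a * a) \<le> 1" "L (nc_star b * b) \<le> 1"
    using L_word_contraction[OF W(1), of 1 0] L_word_contraction[OF W(2), of 1 0] uv(2,3)
    by (simp_all add: a_def b_def L_one)
  moreover have fw: "f w = L (nc_star a * b)"
    by (simp add: a_def b_def nc_star_word nc_word_mult uv(1))
  moreover have "0 \<le> L (nc_star (a + b) * (a + b))" "0 \<le> L (nc_star (a - b) * (a - b))"
    by (intro L_positive nc_space_add nc_space_diff ab)+
  ultimately show ?thesis
    using L_star_mult_commute[OF ab]
    by (simp add: nc_star_add nc_star_diff distrib_left distrib_right left_diff_distrib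
        right_diff_distrib nc_ext_add nc_ext_diff)
qed

text \<open>Edge relations kill the mixed products and idempotence reduces the squares, so the
  double sum in \<open>h * h\<close> collapses to its diagonal and cancels one of the two linear
  sums.\<close>

lemma L_clique_residual:
  assumes "1 \<le> r" "finite S" "S \<subseteq> W" "\<And>x y. x \<in> S \<Longrightarrow> y \<in> S \<Longrightarrow> x \<noteq> y \<Longrightarrow> {x, y} \<in> F"
  defines "h \<equiv> 1 - (\<Sum>x\<in>S. nc_var x)"
  shows "L (nc_star h * h) = 1 - (\<Sum>x\<in>S. L (nc_var x))"
    and "(\<Sum>x\<in>S. L (nc_var x)) \<le> 1"
    and "nc_star h = h" and "h \<in> nc_space W 1"
proof -
  show star: "nc_star h = h"
    by (simp add: h_def nc_star_diff nc_star_sum)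
  show h: "h \<in> nc_space W 1"
    unfolding h_def using assms(3) by (intro nc_space_diff nc_space_sum) (auto simp: nc_space_var)
  have two: "enat (length []) + 2 \<le> 2 * r"
    using assms(1) by (cases r) (auto simp: one_enat_def numeral_eq_enat)
  have prod: "L (nc_var x * nc_var y) = (if y = x then L (nc_var x) else 0)" if "x \<in> S" "y \<in> S" for x y
    using L_word_edge[of "[]" x y] L_word_idem[of "[]" x] assms(3,4) that two
    by (auto simp: nc_ext_diff power2_eq_square)
  have "nc_star h * h = 1 - (\<Sum>x\<in>S. nc_var x) - (\<Sum>x\<in>S. nc_var x)
      + (\<Sum>x\<in>S. \<Sum>y\<in>S. nc_var x * nc_var y)"
    unfolding star unfolding h_def by (simp add: left_diff_distrib right_diff_distrib sum_product)
  moreover have "(\<Sum>x\<in>S. \<Sum>y\<in>S. L (nc_var x * nc_var y)) = (\<Sum>x\<in>S. L (nc_var x))"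
    using assms(2) by (intro sum.cong refl) (simp add: prod cong: sum.cong)
  ultimately show eq: "L (nc_star h * h) = 1 - (\<Sum>x\<in>S. L (nc_var x))"
    by (simp add: nc_ext_diff nc_ext_add nc_ext_sum L_one)
  show "(\<Sum>x\<in>S. L (nc_var x)) \<le> 1"
    using L_positive[OF nc_space_mono[OF h assms(1)]] eq by simp
qed

text \<open>The right part \<open>v\<close> of the word is short enough for \<open>v h\<close> to
  have degree at most \<open>r\<close>; it is null by contraction, and Cauchy-Schwarz then pairs it
  with the left part \<open>u\<close>.\<close>

lemma L_word_mult_null:
  assumes "h \<in> nc_space W s" "L (nc_star h * h) = 0" "s \<le> r"
    "w \<in> lists W" "enat (length w) + s \<le> 2 * r"
  shows "L (nc_word w * h) = 0"
proof -
  obtain u v where uv: "w = u @ v" "enat (length u) \<le> r" "s + enat (length v) \<le> r"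
    using assms by (blast intro: split_word_enat)
  have W: "rev u \<in> lists W" "v \<in> lists W" using assms(4) uv(1) by auto
  have vh: "nc_word v * h \<in> nc_space W r"
    using nc_space_mult[OF nc_space_word[of v W "enat (length v)"] assms(1)] W uv(3)
    by (auto simp: add.commute intro: nc_space_mono)
  have "L (nc_star (nc_word v * h) * (nc_word v * h)) \<le> 0"
    using L_word_contraction[OF W(2) assms(1) uv(3)] assms(2) by simp
  then have "L (nc_star (nc_word v * h) * (nc_word v * h)) = 0"
    using L_positive[OF vh] by simp
  then have "L (nc_star (nc_word (rev u)) * (nc_word v * h)) = 0"
    using L_cauchy_schwarz_zero[OF nc_space_word[OF W(1)] vh] uv(2) by simp
  then show ?thesis
    by (simp add: uv(1) nc_star_word flip: mult.assoc nc_word_mult)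
qed

end

section \<open>Attainment of the supremum\<close>

text \<open>Apart from linearity, which is assumed of \<open>L'\<close>, the conditions read the
  functional only on \<open>nc_space W (2 * r)\<close>.\<close>

lemma nc_feasible_cong:
  assumes "nc_feasible W r H L" "H \<subseteq> nc_space W \<infinity>" "nc_linear W (2 * r) L'"
    and eq: "\<And>p. p \<in> nc_space W (2 * r) \<Longrightarrow> L p = L' p"
  shows "nc_feasible W r H L'"
proof -
  have word: "L (nc_word w) = L' (nc_word w)" if "w \<in> lists W" "enat (length w) \<le> 2 * r" for w
    using that by (intro eq nc_space_word)
  have "L' (nc_star p * p) = L (nc_star p * p)" if "p \<in> nc_space W r" for p
    using nc_space_mult[OF nc_space_star[OF that] that] eq by (simp add: mult_2)
  moreover have "L' q = L q" if mem: "q \<in> nc_ideal W (2 * r) H" for q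
  proof -
    obtain p h where q: "q = p * h" "p \<in> nc_space W \<infinity>" "h \<in> H" "enat (nc_deg q) \<le> 2 * r"
      using mem by (auto simp: nc_ideal_def)
    \<comment> \<open>The factors bound only the variables that occur; the degree bound is that of
      the product itself.\<close>
    have "q \<in> nc_space W (\<infinity> + \<infinity>)"
      unfolding q(1) using q(2,3) assms(2) by (intro nc_space_mult) auto
    then show ?thesis
      using q(4) eq by (simp add: nc_space_def)
  qed
  moreover have "L' 1 = L 1"
    using eq by simp
  moreover have "nc_symmetric W (2 * r) L'"
    unfolding nc_symmetric_def nc_star_word
  proof (intro ballI impI)
    fix w assume w: "w \<in> lists W" "enat (length w) \<le> 2 * r"
    then have "L (nc_word w) = L (nc_word (rev w))"
      using assms(1) unfolding nc_feasible_def nc_symmetric_def nc_star_word by blast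
    moreover have "rev w \<in> lists W"
      using w(1) by auto
    ultimately show "L' (nc_word w) = L' (nc_word (rev w))"
      using w word[of w] word[of "rev w"] by simp
  qed
  moreover have "nc_tracial W (2 * r) L'"
    unfolding nc_tracial_def
  proof (intro ballI impI)
    fix u v assume uv: "u \<in> lists W" "v \<in> lists W" "enat (length (u @ v)) \<le> 2 * r"
    then have "L (nc_word (u @ v)) = L (nc_word (v @ u))"
      using assms(1) unfolding nc_feasible_def nc_tracial_def nc_word_mult by blast
    then show "L' (nc_word u * nc_word v) = L' (nc_word v * nc_word u)"
      using uv word[of "u @ v"] word[of "v @ u"] by (simp add: nc_word_mult add.commute)
  qed
  ultimately show ?thesis
    using assms(1,3) by (simp add: nc_feasible_def nc_positive_def)
qed

lemma nc_feasible_ext: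
  assumes "nc_feasible W r H L" "H \<subseteq> nc_space W \<infinity>"
  obtains f where "nc_feasible W r H (nc_ext f)"
    and "\<And>p. p \<in> nc_space W (2 * r) \<Longrightarrow> L p = nc_ext f p"
    and "\<And>w. w \<notin> lists W \<or> \<not> enat (length w) \<le> 2 * r \<Longrightarrow> f w = 0"
proof -
  \<comment> \<open>The default 0 outside the truncated range keeps \<open>f\<close> in the unit box
    on the words that feasibility does not control.\<close>
  define f where "f w = (if w \<in> lists W \<and> enat (length w) \<le> 2 * r then L (nc_word w) else 0)" for w
  have eq: "L p = nc_ext f p" if "p \<in> nc_space W (2 * r)" for p
    using assms(1) that by (intro nc_linear_eq_ext) (auto simp: nc_feasible_def f_def)
  with assms have "nc_feasible W r H (nc_ext f)"
    by (intro nc_feasible_cong[OF assms nc_linear_ext])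
  then show ?thesis
    using eq by (rule that) (auto simp: f_def)
qed

lemma H_graph_subset_space: "H_graph W F \<subseteq> nc_space W \<infinity>"
proof -
  have var: "nc_var v \<in> nc_space W \<infinity>" if "v \<in> W" for v
    using that by (simp add: nc_space_var)
  have "p * q \<in> nc_space W \<infinity>" if "p \<in> nc_space W \<infinity>" "q \<in> nc_space W \<infinity>" for p q
    using nc_space_mult[OF that] by simp
  with var show ?thesis
    by (auto simp: H_graph_def power2_eq_square intro!: nc_space_diff)
qed

section \<open>Compactness in the product topology\<close>

lemma continuous_on_nc_ext: "continuous_on UNIV (\<lambda>f. nc_ext f p)"
  unfolding nc_ext_def by (intro continuous_intros continuous_on_product_coordinates)

text \<open>Linearity is automatic for \<open>nc_ext f\<close>, and the other conditions are
  equations and weak inequalities between values at fixed polynomials, each continuous in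
  \<open>f\<close> because it depends on finitely many coordinates.\<close>

lemma closed_nc_feasible: "closed {f. nc_feasible W r H (nc_ext f)}"
  unfolding nc_feasible_def nc_symmetric_def nc_tracial_def nc_positive_def Ball_def
  by (simp only: nc_linear_ext simp_thms)
    (intro closed_Collect_conj closed_Collect_all closed_Collect_imp open_Collect_const
      closed_Collect_eq closed_Collect_le continuous_on_nc_ext continuous_on_const)

text \<open>Tychonoff's theorem for a power of \<open>[-1, 1]\<close>.\<close>

lemma compact_unit_box: "compact {f :: 'a \<Rightarrow> real. \<forall>w. \<bar>f w\<bar> \<le> 1}"
proof -
  have "compactin (product_topology (\<lambda>_. euclidean) UNIV) (PiE UNIV (\<lambda>_::'a. {-1..1::real}))"
    unfolding compactin_PiE by simp
  moreover have "PiE UNIV (\<lambda>_::'a. {-1..1::real}) = {f. \<forall>w. \<bar>f w\<bar> \<le> 1}"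
    by (auto simp: PiE_def Pi_def abs_le_iff minus_le_iff)
  ultimately show ?thesis
    by (simp add: euclidean_product_topology)
qed

lemma one_le_two_mult_enat: "1 \<le> r \<Longrightarrow> (1::enat) \<le> 2 * r"
  by (cases r) (auto simp: one_enat_def numeral_eq_enat)

lemma sum_var_in_space: "1 \<le> m \<Longrightarrow> (\<Sum>v\<in>W. nc_var v) \<in> nc_space W m"
  by (intro nc_space_sum nc_space_var)

lemma xi_stab_attained:
  assumes "1 \<le> r" "nc_feasible W r (H_graph W F) L0"
  obtains f where "nc_feasible W r (H_graph W F) (nc_ext f)"
    and "xi_stab r W F = ereal (nc_ext f (\<Sum>v\<in>W. nc_var v))"
proof -
  let ?s = "\<Sum>v\<in>W. nc_var v"
  \<comment> \<open>Cutting down to the unit box loses no value: every feasible functional has a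
    representative there with the same objective.\<close>
  define K where "K = {f. \<forall>w. \<bar>f w\<bar> \<le> 1} \<inter> {f. nc_feasible W r (H_graph W F) (nc_ext f)}"
  have to_K: "\<exists>f\<in>K. L ?s = nc_ext f ?s" if L: "nc_feasible W r (H_graph W F) L" for L
  proof -
    obtain f where f: "nc_feasible W r (H_graph W F) (nc_ext f)"
      "\<And>p. p \<in> nc_space W (2 * r) \<Longrightarrow> L p = nc_ext f p"
      "\<And>w. w \<notin> lists W \<or> \<not> enat (length w) \<le> 2 * r \<Longrightarrow> f w = 0"
      using nc_feasible_ext[OF L H_graph_subset_space] by blast
    interpret nc_graph_functional W F r f by standard (rule f(1))
    have "\<bar>f w\<bar> \<le> 1" for w
      using f(3)[of w] L_word_bound[of w] by fastforce
    moreover have "L ?s = nc_ext f ?s"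
      using assms(1) by (intro f(2) sum_var_in_space one_le_two_mult_enat)
    ultimately show ?thesis
      using f(1) by (auto simp: K_def)
  qed
  have "compact K"
    unfolding K_def by (intro compact_Int_closed compact_unit_box closed_nc_feasible)
  moreover have "K \<noteq> {}"
    using to_K[OF assms(2)] by blast
  moreover have "continuous_on K (\<lambda>f. nc_ext f ?s)"
    by (rule continuous_on_subset[OF continuous_on_nc_ext]) simp
  ultimately obtain f where f: "f \<in> K" "\<And>g. g \<in> K \<Longrightarrow> nc_ext g ?s \<le> nc_ext f ?s"
    using continuous_attains_sup[of K "\<lambda>f. nc_ext f ?s"] by blast
  have feas: "nc_feasible W r (H_graph W F) (nc_ext f)"
    using f(1) by (simp add: K_def)
  have "xi_stab r W F = ereal (nc_ext f ?s)"
    unfolding xi_stab_def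
  proof (rule antisym)
    show "(SUP L\<in>{L. nc_feasible W r (H_graph W F) L}. ereal (L ?s)) \<le> ereal (nc_ext f ?s)"
      using to_K f(2) by (intro SUP_least) fastforce
    show "ereal (nc_ext f ?s) \<le> (SUP L\<in>{L. nc_feasible W r (H_graph W F) L}. ereal (L ?s))"
      using feas by (intro SUP_upper) simp
  qed
  with feas show ?thesis by (rule that)
qed

section \<open>The graphs $K_k \star G$\<close>

text \<open>Edges are unordered, so a witness may list the end points the other way round; the
  condition is invariant under this exchange.\<close>

lemma K_star_edges_iff:
  "{(c, i), (c', j)} \<in> K_star_edges k V E \<longleftrightarrow>
     c \<in> {1..k} \<and> c' \<in> {1..k} \<and> i \<in> V \<and> j \<in> V \<and>
     (c \<noteq> c' \<and> i = j \<or> c = c' \<and> i \<noteq> j \<or> c \<noteq> c' \<and> {i, j} \<in> E)" (is "?l \<longleftrightarrow> ?r")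
proof
  assume ?l
  then show ?r
    by (auto simp: K_star_edges_def doubleton_eq_iff insert_commute)
next
  assume ?r
  then show ?l unfolding K_star_edges_def by blast
qed

lemma sum_K_star_verts: "(\<Sum>v\<in>K_star_verts k V. g v) = (\<Sum>c\<in>{1..k}. \<Sum>i\<in>V. g (c, i))"
  by (simp add: K_star_verts_def sum.cartesian_product split_def)

lemma K_star_row_clique:
  assumes "c \<in> {1..k}"
  shows "Pair c ` V \<subseteq> K_star_verts k V"
    and "x \<in> Pair c ` V \<Longrightarrow> y \<in> Pair c ` V \<Longrightarrow> x \<noteq> y \<Longrightarrow> {x, y} \<in> K_star_edges k V E"
  using assms by (auto simp: K_star_verts_def K_star_edges_iff)

lemma K_star_column_clique:
  assumes "i \<in> V"
  shows "(\<lambda>c. (c, i)) ` {1..k} \<subseteq> K_star_verts k V"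
    and "x \<in> (\<lambda>c. (c, i)) ` {1..k} \<Longrightarrow> y \<in> (\<lambda>c. (c, i)) ` {1..k} \<Longrightarrow> x \<noteq> y \<Longrightarrow>
      {x, y} \<in> K_star_edges k V E"
  using assms by (auto simp: K_star_verts_def K_star_edges_iff)

text \<open>The vertices form a grid with \<open>k\<close> rows and \<open>card V\<close> columns,
  all of them cliques; the last two bounds sum the objective by rows and by columns.\<close>

lemma K_star_sum_bounds:
  assumes "finite V" "1 \<le> r"
    and "nc_feasible (K_star_verts k V) r (H_graph (K_star_verts k V) (K_star_edges k V E)) (nc_ext f)"
  shows "c \<in> {1..k} \<Longrightarrow> (\<Sum>i\<in>V. nc_ext f (nc_var (c, i))) \<le> 1"
    and "nc_ext f (\<Sum>v\<in>K_star_verts k V. nc_var v) \<le> real k"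
    and "nc_ext f (\<Sum>v\<in>K_star_verts k V. nc_var v) \<le> real (card V)"
proof -
  interpret nc_graph_functional "K_star_verts k V" "K_star_edges k V E" r f
    by standard (rule assms(3))
  have row: "(\<Sum>i\<in>V. nc_ext f (nc_var (c, i))) \<le> 1" if "c \<in> {1..k}" for c
    using L_clique_residual(2)[OF assms(2) finite_imageI[OF assms(1)] K_star_row_clique[OF that]]
    by (simp add: sum.reindex inj_on_def)
  then show "c \<in> {1..k} \<Longrightarrow> (\<Sum>i\<in>V. nc_ext f (nc_var (c, i))) \<le> 1" .
  have col: "(\<Sum>c\<in>{1..k}. nc_ext f (nc_var (c, i))) \<le> 1" if "i \<in> V" for i
    using L_clique_residual(2)[OF assms(2) finite_imageI K_star_column_clique[OF that]]
    by (simp add: sum.reindex inj_on_def)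
  have eq: "nc_ext f (\<Sum>v\<in>K_star_verts k V. nc_var v)
      = (\<Sum>c\<in>{1..k}. \<Sum>i\<in>V. nc_ext f (nc_var (c, i)))"
    by (simp add: nc_ext_sum sum_K_star_verts)
  show "nc_ext f (\<Sum>v\<in>K_star_verts k V. nc_var v) \<le> real k"
    unfolding eq using sum_mono[of "{1..k}" _ "\<lambda>_. 1", OF row] by simp
  show "nc_ext f (\<Sum>v\<in>K_star_verts k V. nc_var v) \<le> real (card V)"
    unfolding eq by (subst sum.swap) (use sum_mono[of V _ "\<lambda>_. 1", OF col] in simp)
qed

text \<open>The relations common to \<open>H_graph\<close> and \<open>H_stab\<close>. The two sets
  differ only in having idempotence or the row sums besides.\<close>

definition edge_products :: "nat \<Rightarrow> 'v set \<Rightarrow> 'v set set \<Rightarrow> (nat \<times> 'v) ncpoly set" where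
  "edge_products k V E = {nc_var v * nc_var w | v w. {v, w} \<in> K_star_edges k V E}"

lemma K_star_edges_verts:
  "{v, w} \<in> K_star_edges k V E \<Longrightarrow> v \<in> K_star_verts k V \<and> w \<in> K_star_verts k V"
  by (cases v; cases w) (simp add: K_star_edges_iff K_star_verts_def)

lemma H_graph_K_star:
  "H_graph (K_star_verts k V) (K_star_edges k V E) =
     {nc_var v - nc_var v ^ 2 | v. v \<in> K_star_verts k V} \<union> edge_products k V E"
  unfolding H_graph_def edge_products_def using K_star_edges_verts[of _ _ k V E] by blast

lemma H_stab_K_star:
  "H_stab V E k = {1 - (\<Sum>i\<in>V. nc_var (c, i)) | c. c \<in> {1..k}} \<union> edge_products k V E"
  unfolding H_stab_def
proof (rule arg_cong2[where f = "(\<union>)"])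
  show "{nc_var (c, i) * nc_var (c', j) | c i c' j.
        c \<in> {1..k} \<and> c' \<in> {1..k} \<and> i \<in> V \<and> j \<in> V \<and>
        (i \<noteq> j \<and> c = c' \<or> (i = j \<or> {i, j} \<in> E) \<and> c \<noteq> c')} = edge_products k V E"
    unfolding edge_products_def split_paired_Ex set_eq_iff mem_Collect_eq K_star_edges_iff by blast
qed simp

lemma row_residual_in_space:
  "c \<in> {1..k} \<Longrightarrow> 1 - (\<Sum>i\<in>V. nc_var (c, i)) \<in> nc_space (K_star_verts k V) 1"
  by (intro nc_space_diff nc_space_sum nc_space_one nc_space_var) (auto simp: K_star_verts_def)

lemma H_stab_subset_space: "H_stab V E k \<subseteq> nc_space (K_star_verts k V) \<infinity>"
proof -
  have "1 - (\<Sum>i\<in>V. nc_var (c, i)) \<in> nc_space (K_star_verts k V) \<infinity>" if "c \<in> {1..k}" for c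
    by (rule nc_space_mono[OF row_residual_in_space[OF that]]) simp
  moreover have "edge_products k V E \<subseteq> nc_space (K_star_verts k V) \<infinity>"
    using H_graph_subset_space[of "K_star_verts k V" "K_star_edges k V E"]
    unfolding H_graph_K_star by blast
  ultimately show ?thesis
    unfolding H_stab_K_star by blast
qed

section \<open>Passage between the colouring and the graph relations\<close>

lemma nc_feasible_stab_imp_graph:
  assumes "finite V" "1 \<le> r" and stab: "nc_feasible (K_star_verts k V) r (H_stab V E k) (nc_ext f)"
  shows "nc_feasible (K_star_verts k V) r (H_graph (K_star_verts k V) (K_star_edges k V E)) (nc_ext f)"
    and "nc_ext f (\<Sum>v\<in>K_star_verts k V. nc_var v) = real k"
proof -
  let ?W = "K_star_verts k V" and ?h = "\<lambda>c. 1 - (\<Sum>i\<in>V. nc_var (c, i))"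
  have words: "nc_ext f (nc_word w * h) = 0"
    if "h \<in> H_stab V E k" "w \<in> lists ?W" "enat (length w + nc_deg h) \<le> 2 * r" for w h
    using stab that nc_ideal_vanish_iff[of ?W "2 * r" "H_stab V E k" f]
    unfolding nc_feasible_def by blast
  have row: "nc_ext f (nc_word w * ?h c) = 0"
    if "c \<in> {1..k}" "w \<in> lists ?W" "enat (length w + 1) \<le> 2 * r" for w c
  proof (rule words)
    \<comment> \<open>Equality may fail: for empty \<open>V\<close> the residual is the constant
      1.\<close>
    have "nc_deg (?h c) \<le> 1"
      using row_residual_in_space[OF that(1), of V] by (simp add: nc_space_def one_enat_def)
    then have "enat (length w + nc_deg (?h c)) \<le> enat (length w + 1)" by simp
    then show "enat (length w + nc_deg (?h c)) \<le> 2 * r"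
      using that(3) by (rule order_trans)
  qed (use that in \<open>auto simp: H_stab_K_star\<close>)
  have idem: "nc_ext f (nc_word w * (nc_var v - nc_var v ^ 2)) = 0"
    if v: "v \<in> ?W" and w: "w \<in> lists ?W"
      and deg: "enat (length w + nc_deg (nc_var v - nc_var v ^ 2)) \<le> 2 * r" for v w
  proof -
    obtain c i where ci: "v = (c, i)" "c \<in> {1..k}" "i \<in> V"
      using v by (auto simp: K_star_verts_def)
    \<comment> \<open>The relation has degree at least 2, so the budget leaves room for two letters
      after \<open>w\<close>.\<close>
    have "[v, v] \<in> Poly_Mapping.keys (nc_var v - nc_var v ^ 2)"
      by (simp add: nc_var_def power2_eq_square nc_word_mult)
        (simp add: in_keys_iff lookup_minus nc_word_def lookup_single)
    from length_le_nc_deg[OF this] have "enat (length w + 2) \<le> 2 * r"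
      using deg by (auto elim!: order_trans[rotated])
    then have len: "enat (length (w @ [v]) + 1) \<le> 2 * r" "enat (length w + 2) \<le> 2 * r"
      by simp_all
    \<comment> \<open>Distinct vertices of one row are adjacent, so only the diagonal term of the
      row sum survives.\<close>
    have off: "nc_ext f (nc_word w * (nc_var v * nc_var (c, j))) = 0" if "j \<in> V" "j \<noteq> i" for j
    proof (rule words)
      have "{v, (c, j)} \<in> K_star_edges k V E"
        using that ci by (simp add: K_star_edges_iff)
      then show "nc_var v * nc_var (c, j) \<in> H_stab V E k"
        unfolding H_stab_K_star edge_products_def by blast
    qed (use len(2) w in simp_all)
    have "(\<Sum>j\<in>V. nc_ext f (nc_word w * (nc_var v * nc_var (c, j))))
        = (\<Sum>j\<in>V. if j = i then nc_ext f (nc_word w * (nc_var v * nc_var v)) else 0)"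
      using off ci by (intro sum.cong) auto
    also have "\<dots> = nc_ext f (nc_word w * (nc_var v * nc_var v))"
      using assms(1) ci by simp
    finally have sum: "(\<Sum>j\<in>V. nc_ext f (nc_word w * (nc_var v * nc_var (c, j))))
        = nc_ext f (nc_word w * (nc_var v * nc_var v))" .
    \<comment> \<open>The row relation behind \<open>w @ [v]\<close> has the same total degree
      \<open>length w + 2\<close> as the idempotence relation behind \<open>w\<close>, so no degree
      is lost.\<close>
    have "nc_ext f (nc_word (w @ [v]) * ?h c) = 0"
      using v w by (intro row[OF ci(2) _ len(1)]) auto
    also have "nc_word (w @ [v]) = nc_word w * nc_var v"
      by (simp add: nc_var_def nc_word_mult)
    finally show ?thesis
      using sum by (simp add: right_diff_distrib sum_distrib_left nc_ext_diff nc_ext_sum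
          mult.assoc power2_eq_square)
  qed
  have "\<forall>q\<in>nc_ideal ?W (2 * r) (H_graph ?W (K_star_edges k V E)). nc_ext f q = 0"
    unfolding nc_ideal_vanish_iff H_graph_K_star
    using idem words[unfolded H_stab_K_star] by blast
  then show "nc_feasible ?W r (H_graph ?W (K_star_edges k V E)) (nc_ext f)"
    using stab by (simp add: nc_feasible_def)
  \<comment> \<open>This is the row relation multiplied by the empty word.\<close>
  have "(\<Sum>i\<in>V. nc_ext f (nc_var (c, i))) = 1" if "c \<in> {1..k}" for c
  proof -
    have "nc_ext f 1 = 1"
      using stab by (simp add: nc_feasible_def)
    then show ?thesis
      using row[OF that, of "[]"] one_le_two_mult_enat[OF assms(2)]
      by (simp add: nc_ext_diff nc_ext_sum one_enat_def)
  qed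
  then show "nc_ext f (\<Sum>v\<in>?W. nc_var v) = real k"
    by (simp add: nc_ext_sum sum_K_star_verts)
qed

lemma nc_feasible_graph_imp_stab:
  assumes "finite V" "1 \<le> r"
    and graph: "nc_feasible (K_star_verts k V) r
      (H_graph (K_star_verts k V) (K_star_edges k V E)) (nc_ext f)"
    and eq: "nc_ext f (\<Sum>v\<in>K_star_verts k V. nc_var v) = real k"
  shows "nc_feasible (K_star_verts k V) r (H_stab V E k) (nc_ext f)"
proof -
  let ?W = "K_star_verts k V" and ?h = "\<lambda>c. 1 - (\<Sum>i\<in>V. nc_var (c, i))"
  let ?row = "\<lambda>c. \<Sum>i\<in>V. nc_ext f (nc_var (c, i))"
  interpret nc_graph_functional ?W "K_star_edges k V E" r f
    by standard (rule graph)
  have words: "nc_ext f (nc_word w * h) = 0"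
    if "h \<in> edge_products k V E" "w \<in> lists ?W" "enat (length w + nc_deg h) \<le> 2 * r" for w h
    using graph that nc_ideal_vanish_iff[of ?W "2 * r" "H_graph ?W (K_star_edges k V E)" f]
    unfolding nc_feasible_def H_graph_K_star by blast
  \<comment> \<open>The \<open>k\<close> row slacks are nonnegative and sum to 0, so each row sum
    equals 1.\<close>
  have "(\<Sum>c\<in>{1..k}. 1 - ?row c) = 0"
    using eq by (simp add: nc_ext_sum sum_K_star_verts sum_subtractf)
  moreover have "\<forall>c\<in>{1..k}. 0 \<le> 1 - ?row c"
    using K_star_sum_bounds(1)[OF assms(1,2) graph] by simp
  ultimately have tight: "?row c = 1" if "c \<in> {1..k}" for c
    using sum_nonneg_eq_0_iff[of "{1..k}" "\<lambda>c. 1 - ?row c"] that by simp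
  have row: "nc_ext f (nc_word w * ?h c) = 0"
    if c: "c \<in> {1..k}" and w: "w \<in> lists ?W" and deg: "enat (length w + nc_deg (?h c)) \<le> 2 * r" for c w
  proof -
    \<comment> \<open>A row sum of 1 forces \<open>V\<close> to be nonempty. Then the residual
      really has degree 1, and the degree condition leaves room for one letter after
      \<open>w\<close>.\<close>
    obtain i where i: "i \<in> V"
      using tight[OF c] by (metis all_not_in_conv sum.empty zero_neq_one)
    have "Poly_Mapping.lookup (?h c) [(c, i)] = - (\<Sum>j\<in>V. if j = i then 1 else 0)"
      by (simp add: lookup_minus lookup_sum lookup_one nc_var_def nc_word_def lookup_single when_def)
    then have "[(c, i)] \<in> Poly_Mapping.keys (?h c)"
      using i assms(1) by (simp add: in_keys_iff)
    from length_le_nc_deg[OF this] have "enat (length w + 1) \<le> 2 * r"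
      using deg by (auto elim!: order_trans[rotated])
    then have len: "enat (length w) + 1 \<le> 2 * r"
      by (simp add: one_enat_def)
    \<comment> \<open>Tightness makes the residual a null polynomial of degree at most 1, to which
      \<open>L_word_mult_null\<close> applies.\<close>
    from L_clique_residual[OF assms(2) finite_imageI[OF assms(1)] K_star_row_clique[OF c]]
    have "nc_ext f (nc_star (?h c) * ?h c) = 0" "?h c \<in> nc_space ?W 1"
      using tight[OF c] by (simp_all add: sum.reindex inj_on_def)
    then show ?thesis
      using assms(2) w len by (intro L_word_mult_null)
  qed
  have "\<forall>q\<in>nc_ideal ?W (2 * r) (H_stab V E k). nc_ext f q = 0"
    unfolding nc_ideal_vanish_iff using row words by (auto simp: H_stab_K_star)
  then show ?thesis
    using graph by (simp add: nc_feasible_def)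
qed

section \<open>Comparison of the two sets of numbers\<close>

lemma zero_in_gamma_stab_set: "0 \<in> gamma_stab_set r V E"
proof -
  define f :: "(nat \<times> 'a) list \<Rightarrow> real" where "f w = (if w = [] then 1 else 0)" for w
  let ?W = "{1..0::nat} \<times> V"
  have W: "?W = {}" by simp
  have f: "nc_ext f p = Poly_Mapping.lookup p []" for p
    by (simp add: nc_ext_def f_def if_distrib[of "(*) _"] cong: if_cong)
      (auto simp: not_in_keys_iff_lookup_eq_zero[symmetric])
  have "0 \<le> nc_ext f (nc_star p * p)" if "p \<in> nc_space ?W r" for p
  proof -
    \<comment> \<open>Without colours there are no variables, so \<open>p\<close> is a constant
      \<open>a\<close> and the functional, which reads off the constant term, takes the value
      \<open>a * a\<close>.\<close>
    have "Poly_Mapping.keys p \<subseteq> {[]}"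
      using that unfolding W by (auto simp: nc_space_def)
    then have "p = Poly_Mapping.single [] (Poly_Mapping.lookup p [])"
      using ncpoly_expand[of "{[]}" p] by simp
    then obtain a where p: "p = Poly_Mapping.single [] a" ..
    show ?thesis
      by (simp add: p nc_star_single mult_single plus_list_def nc_ext_single f_def)
  qed
  moreover have "nc_ideal ?W (2 * r) (H_stab V E 0) = {}"
    by (simp add: nc_ideal_def H_stab_def)
  moreover have "nc_ext f 1 = 1"
    by (simp add: f lookup_one)
  ultimately have "nc_feasible ?W r (H_stab V E 0) (nc_ext f)"
    unfolding nc_feasible_def W
    by (simp add: nc_linear_ext nc_positive_def nc_symmetric_def nc_tracial_def nc_star_word)
  then show ?thesis
    unfolding gamma_stab_set_def by blast
qed

text \<open>An arbitrary representative is first replaced by an extension of word values; the two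
  passages between the relations then apply.\<close>

lemma mem_gamma_stab_set_iff:
  assumes "finite V" "1 \<le> r"
  shows "k \<in> gamma_stab_set r V E \<longleftrightarrow>
    (\<exists>f. nc_feasible (K_star_verts k V) r (H_graph (K_star_verts k V) (K_star_edges k V E)) (nc_ext f)
      \<and> nc_ext f (\<Sum>v\<in>K_star_verts k V. nc_var v) = real k)"
proof -
  have "k \<in> gamma_stab_set r V E \<longleftrightarrow> (\<exists>L. nc_feasible (K_star_verts k V) r (H_stab V E k) L)"
    by (simp add: gamma_stab_set_def K_star_verts_def)
  also have "\<dots> \<longleftrightarrow> (\<exists>f. nc_feasible (K_star_verts k V) r (H_stab V E k) (nc_ext f))"
  proof
    assume "\<exists>L. nc_feasible (K_star_verts k V) r (H_stab V E k) L"
    then obtain L where L: "nc_feasible (K_star_verts k V) r (H_stab V E k) L" ..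
    show "\<exists>f. nc_feasible (K_star_verts k V) r (H_stab V E k) (nc_ext f)"
      by (rule nc_feasible_ext[OF L H_stab_subset_space]) (rule exI)
  qed blast
  finally show ?thesis
    using nc_feasible_stab_imp_graph[OF assms] nc_feasible_graph_imp_stab[OF assms] by blast
qed

lemma xi_stab_K_star_le:
  assumes "finite V" "1 \<le> r"
  shows "xi_stab r (K_star_verts k V) (K_star_edges k V E) \<le> ereal (real k)"
  unfolding xi_stab_def
proof (rule SUP_least)
  fix L assume "L \<in> {L. nc_feasible (K_star_verts k V) r
    (H_graph (K_star_verts k V) (K_star_edges k V E)) L}"
  then have L: "nc_feasible (K_star_verts k V) r
    (H_graph (K_star_verts k V) (K_star_edges k V E)) L" by simp
  obtain f where
    "nc_feasible (K_star_verts k V) r (H_graph (K_star_verts k V) (K_star_edges k V E)) (nc_ext f)"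
    "\<And>p. p \<in> nc_space (K_star_verts k V) (2 * r) \<Longrightarrow> L p = nc_ext f p"
    by (rule nc_feasible_ext[OF L H_graph_subset_space]) (rule that)
  then show "ereal (L (\<Sum>v\<in>K_star_verts k V. nc_var v)) \<le> ereal (real k)"
    using K_star_sum_bounds(2)[OF assms]
      sum_var_in_space[OF one_le_two_mult_enat[OF assms(2)], of "K_star_verts k V"] by simp
qed

text \<open>A functional of value \<open>k\<close> meets the upper bound \<open>k\<close> for the
  supremum; conversely, attainment turns the value of the supremum into that of a
  functional.\<close>

lemma gamma_stab_set_eq:
  assumes "finite V" "1 \<le> r"
  shows "gamma_stab_set r V E =
    {k. xi_stab r (K_star_verts k V) (K_star_edges k V E) = ereal (real k)}"
proof (intro set_eqI iffI; clarify?)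
  fix k assume "k \<in> gamma_stab_set r V E"
  then obtain f where
    "nc_feasible (K_star_verts k V) r (H_graph (K_star_verts k V) (K_star_edges k V E)) (nc_ext f)"
    and f: "nc_ext f (\<Sum>v\<in>K_star_verts k V. nc_var v) = real k"
    using mem_gamma_stab_set_iff[OF assms] by blast
  then have "ereal (nc_ext f (\<Sum>v\<in>K_star_verts k V. nc_var v))
      \<le> xi_stab r (K_star_verts k V) (K_star_edges k V E)"
    unfolding xi_stab_def by (intro SUP_upper) simp
  with f xi_stab_K_star_le[OF assms]
  show "xi_stab r (K_star_verts k V) (K_star_edges k V E) = ereal (real k)"
    by (intro antisym) simp_all
next
  fix k assume xi: "xi_stab r (K_star_verts k V) (K_star_edges k V E) = ereal (real k)"
  \<comment> \<open>A supremum over no functionals would be minus infinity, so the finite value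
    \<open>k\<close> provides the functional from which attainment starts.\<close>
  have "{L. nc_feasible (K_star_verts k V) r
      (H_graph (K_star_verts k V) (K_star_edges k V E)) L} \<noteq> {}"
  proof
    assume "{L. nc_feasible (K_star_verts k V) r
      (H_graph (K_star_verts k V) (K_star_edges k V E)) L} = {}"
    then show False
      using xi by (simp add: xi_stab_def bot_ereal_def)
  qed
  then obtain L where L: "nc_feasible (K_star_verts k V) r
      (H_graph (K_star_verts k V) (K_star_edges k V E)) L"
    by blast
  obtain f where
    "nc_feasible (K_star_verts k V) r (H_graph (K_star_verts k V) (K_star_edges k V E)) (nc_ext f)"
    "xi_stab r (K_star_verts k V) (K_star_edges k V E)
      = ereal (nc_ext f (\<Sum>v\<in>K_star_verts k V. nc_var v))"
    by (rule xi_stab_attained[OF assms(2) L])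
  with xi have "nc_feasible (K_star_verts k V) r
      (H_graph (K_star_verts k V) (K_star_edges k V E)) (nc_ext f) \<and>
      nc_ext f (\<Sum>v\<in>K_star_verts k V. nc_var v) = real k"
    by simp
  then show "k \<in> gamma_stab_set r V E"
    unfolding mem_gamma_stab_set_iff[OF assms] by blast
qed

text \<open>The column bound caps the value \<open>k\<close> by \<open>card V\<close>.\<close>

lemma gamma_stab_set_subset:
  assumes "finite V" "1 \<le> r"
  shows "gamma_stab_set r V E \<subseteq> {..card V}"
proof
  fix k assume "k \<in> gamma_stab_set r V E"
  then obtain f where
    "nc_feasible (K_star_verts k V) r (H_graph (K_star_verts k V) (K_star_edges k V E)) (nc_ext f)"
    and f: "nc_ext f (\<Sum>v\<in>K_star_verts k V. nc_var v) = real k"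
    using mem_gamma_stab_set_iff[OF assms] by blast
  from K_star_sum_bounds(3)[OF assms this(1)] f show "k \<in> {..card V}" by simp
qed

theorem proposition3p11:
  fixes V :: "'v set" and E :: "'v set set" and r :: enat
  assumes "finite_graph V E" and "1 \<le> r"
  shows "finite (gamma_stab_set r V E) \<and> gamma_stab_set r V E \<noteq> {} \<and>
    finite {k::nat. xi_stab r (K_star_verts k V) (K_star_edges k V E) = ereal (real k)} \<and>
    {k::nat. xi_stab r (K_star_verts k V) (K_star_edges k V E) = ereal (real k)} \<noteq> {} \<and>
    gamma_stab r V E =
      Max {k::nat. xi_stab r (K_star_verts k V) (K_star_edges k V E) = ereal (real k)}"
proof -
  have V: "finite V"
    using assms(1) by (simp add: finite_graph_def)
  \<comment> \<open>Finiteness and nonemptiness make \<open>Max\<close> a genuine maximum; the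
    equality of the sets transfers both.\<close>
  have "finite (gamma_stab_set r V E)"
    using gamma_stab_set_subset[OF V assms(2)] by (rule finite_subset) simp
  moreover have "gamma_stab_set r V E \<noteq> {}"
    using zero_in_gamma_stab_set by blast
  ultimately show ?thesis
    by (simp add: gamma_stab_def flip: gamma_stab_set_eq[OF V assms(2)])
qed

end
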